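(* Fix any $R \ge 1$, any $L \ge 1$, and any $0 < \epsilon \le 1$. Let $\mathcal{F}(R)$ be the class of convex, $L$-smooth functions $f : \mathbb{R}^d \to \mathbb{R}$ that attain their minimum and whose smallest-norm minimizer $w^*$ satisfies $\|w^*\| \le R$. No algorithm working with an $\epsilon$-AGP oracle can guarantee, for every $f \in \mathcal{F}(R)$, to return a $w \in \mathbb{R}^d$ such that $f(w) < f(w^* ) + \epsilon R/2$. This holds even if the algorithm calls the oracle an infinite number of times.
   Context: All norms are Euclidean. A differentiable function is $L$-smooth if its gradient is $L$-Lipschitz. An $\epsilon$-AGP (adversarial gradient perturbation) oracle for $f$ is a procedure that, when called with a point $w \in \mathbb{R}^d$, returns a vector $\mathrm{oracle}(w) \in \mathbb{R}^d$ with $\|\mathrm{oracle}(w) - \nabla f(w)\| \le \epsilon$; the returned vector is otherwise arbitrary (possibly adversarial). An algorithm adaptively chooses query points, each depending only on previous oracle answers (and on the fixed values $R,L,\epsilon$), and returns a point depending only on the (possibly infinite) sequence of answers. "Guarantee" means that the output is correct for every $f\in\mathcal{F}(R)$ and every $\epsilon$-AGP oracle for $f$. *)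

theory Defs
  imports "HOL-Analysis.Analysis"
begin

definition gradient :: "('a::real_inner \<Rightarrow> real) \<Rightarrow> 'a \<Rightarrow> 'a" where
  "gradient f x = (THE D. GDERIV f x :> D)"

lemma gradient_eqI:
  fixes f :: "'a::real_inner \<Rightarrow> real"
  assumes "GDERIV f x :> D"
  shows "gradient f x = D"
  unfolding gradient_def
proof (rule the_equality)
  fix E assume "GDERIV f x :> E"
  then have "(\<lambda>h. h \<bullet> E) = (\<lambda>h. h \<bullet> D)"
    using assms unfolding gderiv_def by (rule has_derivative_unique)
  then have "(E - D) \<bullet> E = (E - D) \<bullet> D" by metis
  then have "(E - D) \<bullet> (E - D) = 0" by (simp add: inner_diff_right)
  then show "E = D" by simp
qed (rule assms)

lemma GDERIV_gradient:
  fixes f :: "'a::euclidean_space \<Rightarrow> real"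
  assumes "f differentiable (at x)"
  shows "GDERIV f x :> gradient f x"
proof -
  obtain f' where f': "(f has_derivative f') (at x)"
    using assms unfolding differentiable_def by blast
  have "f' h = h \<bullet> (\<Sum>b\<in>Basis. f' b *\<^sub>R b)" for h
  proof -
    interpret linear f' using f' by (rule has_derivative_linear)
    have "f' h = f' (\<Sum>b\<in>Basis. (h \<bullet> b) *\<^sub>R b)" by (simp add: euclidean_representation)
    also have "\<dots> = (\<Sum>b\<in>Basis. (h \<bullet> b) * f' b)" by (simp add: sum scale)
    finally show ?thesis by (simp add: inner_sum_right mult.commute)
  qed
  then have "f' = (\<lambda>h. h \<bullet> (\<Sum>b\<in>Basis. f' b *\<^sub>R b))" by blast
  then have "GDERIV f x :> (\<Sum>b\<in>Basis. f' b *\<^sub>R b)"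
    using f' unfolding gderiv_def by simp
  then show ?thesis by (metis gradient_eqI)
qed

definition smooth_function :: "real \<Rightarrow> ('a::euclidean_space \<Rightarrow> real) \<Rightarrow> bool" where
  "smooth_function L f \<longleftrightarrow>
     (\<forall>x. f differentiable (at x)) \<and> lipschitz_on L UNIV (gradient f)"

definition minimizer :: "('a \<Rightarrow> real) \<Rightarrow> 'a \<Rightarrow> bool" where
  "minimizer f = is_arg_min f (\<lambda>_. True)"

definition smallest_norm_minimizer :: "('a::real_normed_vector \<Rightarrow> real) \<Rightarrow> 'a \<Rightarrow> bool" where
  "smallest_norm_minimizer f = is_arg_min norm (minimizer f)"

definition function_class :: "real \<Rightarrow> real \<Rightarrow> ('a::euclidean_space \<Rightarrow> real) set" where
  "function_class L R =
     {f. convex_on UNIV f \<and> smooth_function L f \<and>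
         (\<exists>wstar. smallest_norm_minimizer f wstar \<and> norm wstar \<le> R)}"

(* The oracle is a fixed (but arbitrary) function of the query point.  Allowing answers that also
   depend on the query history would enlarge the class of oracles, hence make an impossibility
   result about algorithms weaker. *)
definition agp_oracle :: "real \<Rightarrow> ('a::euclidean_space \<Rightarrow> real) \<Rightarrow> ('a \<Rightarrow> 'a) \<Rightarrow> bool" where
  "agp_oracle \<epsilon> f orc \<longleftrightarrow> (\<forall>w. norm (orc w - gradient f w) \<le> \<epsilon>)"

datatype 'a move = Query 'a | Return 'a

(* Given the list of oracle answers received so far (oldest first), the strategy either queries
   another point or stops and returns a point.  If it never stops, the returned point is
   determined by the infinite sequence of answers through limit_output. *)
datatype 'a algorithm =
  Algorithm (strategy: "'a list \<Rightarrow> 'a move") (limit_output: "(nat \<Rightarrow> 'a) \<Rightarrow> 'a")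

(* The answers received within the first n rounds; constant from the moment of stopping. *)
primrec answers :: "'a algorithm \<Rightarrow> ('a \<Rightarrow> 'a) \<Rightarrow> nat \<Rightarrow> 'a list" where
  "answers alg orc 0 = []"
| "answers alg orc (Suc n) =
     (case strategy alg (answers alg orc n) of
        Query w \<Rightarrow> answers alg orc n @ [orc w]
      | Return _ \<Rightarrow> answers alg orc n)"

definition run :: "'a algorithm \<Rightarrow> ('a \<Rightarrow> 'a) \<Rightarrow> 'a" where
  "run alg orc =
     (if \<exists>n w. strategy alg (answers alg orc n) = Return w
      then THE w. \<exists>n. strategy alg (answers alg orc n) = Return w
      else limit_output alg (\<lambda>n. answers alg orc (Suc n) ! n))"

lemma answers_stop:
  assumes "strategy alg (answers alg orc n) = Return w" and "n \<le> m"
  shows "answers alg orc m = answers alg orc n"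
  using assms(2) by (induction m rule: dec_induct) (simp_all add: assms(1))

lemma run_stop:
  assumes "strategy alg (answers alg orc n) = Return w"
  shows "run alg orc = w"
proof -
  have "v = w" if "strategy alg (answers alg orc m) = Return v" for m v
    using answers_stop[OF assms, of m] answers_stop[OF that, of n] assms that
    by (cases "n \<le> m") auto
  then have "(THE v. \<exists>n. strategy alg (answers alg orc n) = Return v) = w"
    using assms by (intro the_equality) blast+
  then show ?thesis using assms unfolding run_def by auto
qed

lemma answers_infinite:
  assumes "\<And>n w. strategy alg (answers alg orc n) \<noteq> Return w"
  shows "length (answers alg orc n) = n"
    and "answers alg orc n = map (\<lambda>k. answers alg orc (Suc k) ! k) [0..<n]"
proof -
  have Q: "\<exists>w. strategy alg (answers alg orc n) = Query w" for n
    using assms[of n] by (cases "strategy alg (answers alg orc n)") auto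
  show len: "length (answers alg orc n) = n" for n
  proof (induction n)
    case (Suc n)
    then show ?case using Q[of n] by auto
  qed simp
  show "answers alg orc n = map (\<lambda>k. answers alg orc (Suc k) ! k) [0..<n]"
  proof (induction n)
    case (Suc n)
    obtain w where "answers alg orc (Suc n) = answers alg orc n @ [orc w]"
      using Q[of n] by auto
    then have "answers alg orc (Suc n) = answers alg orc n @ [answers alg orc (Suc n) ! n]"
      using len[of n] by (metis nth_append_length)
    with Suc.IH show ?case by (simp del: answers.simps)
  qed simp
qed

end

theory Submission
  imports Defs
begin

text \<open>
  For a unit vector \<open>e\<close>, apply the Huber function with slope at most \<open>\<epsilon>\<close> to \<open>w \<bullet> e - R\<close>. All its
  gradients have norm at most \<open>\<epsilon>\<close>, so the oracle that always answers \<open>0\<close> is admissible, and the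
  algorithm cannot distinguish \<open>e\<close> from \<open>- e\<close>. Its output lies on the wrong side of the origin for
  one of the two functions, which there is at least \<open>\<epsilon> * R - \<epsilon>\<^sup>2 / 2 \<ge> \<epsilon> * R / 2\<close>.
\<close>

text \<open>For \<open>0 \<le> \<epsilon>\<close> this is the projection onto the interval from
  \<open>- \<epsilon>\<close> to \<open>\<epsilon>\<close>; it serves as the derivative of
  \<open>huber\<close>.\<close>

definition clamp_abs :: "real \<Rightarrow> real \<Rightarrow> real" where
  "clamp_abs \<epsilon> t = max (- \<epsilon>) (min \<epsilon> t)"

text \<open>Equals \<open>t\<^sup>2 / 2\<close> for \<open>\<bar>t\<bar> \<le> \<epsilon>\<close> and \<open>\<epsilon> * \<bar>t\<bar> - \<epsilon>\<^sup>2 / 2\<close> otherwise.\<close>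

definition huber :: "real \<Rightarrow> real \<Rightarrow> real" where
  "huber \<epsilon> t = clamp_abs \<epsilon> t * t - (clamp_abs \<epsilon> t)\<^sup>2 / 2"

lemma abs_clamp_abs_le: "0 \<le> \<epsilon> \<Longrightarrow> \<bar>clamp_abs \<epsilon> t\<bar> \<le> \<epsilon>"
  by (auto simp: clamp_abs_def)

lemma clamp_abs_mono: "s \<le> t \<Longrightarrow> clamp_abs \<epsilon> s \<le> clamp_abs \<epsilon> t"
  by (auto simp: clamp_abs_def)

lemma clamp_abs_diff_le: "\<bar>clamp_abs \<epsilon> s - clamp_abs \<epsilon> t\<bar> \<le> \<bar>s - t\<bar>"
  by (auto simp: clamp_abs_def)

text \<open>Variational inequality of the projection: the residual vanishes unless \<open>t\<close>
  lies outside the interval, and then it points outward from the endpoint, away from every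
  admissible \<open>s\<close>.\<close>

lemma clamp_abs_variational:
  assumes "\<bar>s\<bar> \<le> \<epsilon>"
  shows "0 \<le> (t - clamp_abs \<epsilon> t) * (clamp_abs \<epsilon> t - s)"
  using assms by (auto simp: clamp_abs_def max_def min_def zero_le_mult_iff)

text \<open>Each admissible slope \<open>s\<close> gives an affine minorant of \<open>huber\<close>,
  with equality at \<open>t\<close> when \<open>s = clamp_abs \<epsilon> t\<close>. Nonnegativity,
  the derivative and the final lower bound all come from choices of \<open>s\<close>.\<close>

lemma huber_ge:
  assumes "\<bar>s\<bar> \<le> \<epsilon>"
  shows "s * t - s\<^sup>2 / 2 \<le> huber \<epsilon> t"
proof -
  define c where "c = clamp_abs \<epsilon> t"
  have "huber \<epsilon> t - (s * t - s\<^sup>2 / 2) = (t - c) * (c - s) + (c - s)\<^sup>2 / 2"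
    unfolding huber_def c_def by (simp add: power2_eq_square field_simps)
  then show ?thesis
    using clamp_abs_variational[OF assms, of t] zero_le_power2[of "c - s"] unfolding c_def by linarith
qed

lemma huber_nonneg: "0 \<le> \<epsilon> \<Longrightarrow> 0 \<le> huber \<epsilon> t"
  using huber_ge[of 0 \<epsilon> t] by simp

lemma huber_zero_iff: "0 < \<epsilon> \<Longrightarrow> huber \<epsilon> t = 0 \<longleftrightarrow> t = 0"
proof
  assume "0 < \<epsilon>" "huber \<epsilon> t = 0"
  moreover define c where "c = clamp_abs \<epsilon> t"
  \<comment> \<open>The value of \<open>huber\<close> splits into two nonnegative summands, so both
    vanish.\<close>
  ultimately have "(t - c) * c + c\<^sup>2 / 2 = 0" "0 \<le> (t - c) * c"
    using clamp_abs_variational[of 0 \<epsilon> t]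
    by (auto simp: huber_def c_def power2_eq_square algebra_simps)
  then have "c\<^sup>2 \<le> 0" by linarith
  then have "c = 0" by simp
  then show "t = 0" using \<open>0 < \<epsilon>\<close> by (auto simp: c_def clamp_abs_def max_def min_def split: if_splits)
qed (simp add: huber_def clamp_abs_def)

text \<open>The minorants at \<open>x\<close> and at \<open>y\<close> enclose the increment between
  two slopes times \<open>y - x\<close>. As the clamp is nonexpansive, the difference quotient errs
  by at most \<open>\<bar>y - x\<bar>\<close>, with no case split at the points where the formula
  changes.\<close>

lemma DERIV_huber:
  assumes "0 \<le> \<epsilon>"
  shows "DERIV (huber \<epsilon>) x :> clamp_abs \<epsilon> x"
proof -
  let ?c = "clamp_abs \<epsilon>"
  have bound: "norm ((huber \<epsilon> y - huber \<epsilon> x) / (y - x) - ?c x) \<le> \<bar>y - x\<bar>" if "y \<noteq> x" for y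
  proof -
    have lower: "?c x * (y - x) \<le> huber \<epsilon> y - huber \<epsilon> x"
      using huber_ge[OF abs_clamp_abs_le[OF assms, of x], of y]
      by (simp add: huber_def[of \<epsilon> x] algebra_simps)
    have upper: "huber \<epsilon> y - huber \<epsilon> x \<le> ?c y * (y - x)"
      using huber_ge[OF abs_clamp_abs_le[OF assms, of y], of x]
      by (simp add: huber_def[of \<epsilon> y] algebra_simps)
    have "\<bar>huber \<epsilon> y - huber \<epsilon> x - ?c x * (y - x)\<bar> \<le> (?c y - ?c x) * (y - x)"
      using lower upper by (simp add: left_diff_distrib)
    also have "\<dots> \<le> \<bar>y - x\<bar> * \<bar>y - x\<bar>"
      using mult_right_mono[OF clamp_abs_diff_le[of \<epsilon> y x], of "\<bar>y - x\<bar>"]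
        abs_ge_self[of "(?c y - ?c x) * (y - x)"] by (simp add: abs_mult)
    finally have "\<bar>huber \<epsilon> y - huber \<epsilon> x - ?c x * (y - x)\<bar> / \<bar>y - x\<bar> \<le> \<bar>y - x\<bar>"
      using that by (simp add: pos_divide_le_eq)
    moreover have "(huber \<epsilon> y - huber \<epsilon> x) / (y - x) - ?c x
        = (huber \<epsilon> y - huber \<epsilon> x - ?c x * (y - x)) / (y - x)"
      using that by (simp add: field_simps)
    ultimately show ?thesis by simp
  qed
  have "((\<lambda>y. (huber \<epsilon> y - huber \<epsilon> x) / (y - x) - ?c x) \<longlongrightarrow> 0) (at x)"
  proof (rule Lim_null_comparison)
    show "\<forall>\<^sub>F y in at x. norm ((huber \<epsilon> y - huber \<epsilon> x) / (y - x) - ?c x) \<le> \<bar>y - x\<bar>"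
      using bound by (auto simp: eventually_at_filter)
    show "((\<lambda>y. \<bar>y - x\<bar>) \<longlongrightarrow> 0) (at x)"
      by (auto intro!: tendsto_eq_intros)
  qed
  then show ?thesis
    by (simp add: has_field_derivative_iff LIM_zero_iff)
qed

lemma convex_on_huber:
  assumes "0 \<le> \<epsilon>"
  shows "convex_on UNIV (huber \<epsilon>)"
  by (rule convex_on_realI[where f' = "clamp_abs \<epsilon>"])
    (auto simp: DERIV_huber[OF assms] clamp_abs_mono)

text \<open>For a unit vector \<open>e\<close>, the shift by \<open>R\<close> puts the point of
  least norm on the minimizing hyperplane at distance exactly \<open>R\<close>, the largest that the
  class allows.\<close>

definition ridge_huber :: "real \<Rightarrow> real \<Rightarrow> 'a::real_inner \<Rightarrow> 'a \<Rightarrow> real" where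
  "ridge_huber \<epsilon> R e w = huber \<epsilon> (w \<bullet> e - R)"

lemma GDERIV_ridge_huber:
  assumes "0 \<le> \<epsilon>"
  shows "GDERIV (ridge_huber \<epsilon> R e) w :> clamp_abs \<epsilon> (w \<bullet> e - R) *\<^sub>R e"
proof -
  have "GDERIV (\<lambda>w. w \<bullet> e - R) w :> e"
    unfolding gderiv_def by (auto intro!: derivative_eq_intros)
  from GDERIV_DERIV_compose[OF this DERIV_huber[OF assms]]
  show ?thesis by (simp add: ridge_huber_def[abs_def])
qed

lemma gradient_ridge_huber:
  "0 \<le> \<epsilon> \<Longrightarrow> gradient (ridge_huber \<epsilon> R e) w = clamp_abs \<epsilon> (w \<bullet> e - R) *\<^sub>R e"
  by (rule gradient_eqI[OF GDERIV_ridge_huber])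

lemma convex_on_ridge_huber:
  assumes "0 \<le> \<epsilon>"
  shows "convex_on UNIV (ridge_huber \<epsilon> R e)"
proof (rule convex_onI)
  fix t :: real and x y assume t: "0 < t" "t < 1"
  have "((1 - t) *\<^sub>R x + t *\<^sub>R y) \<bullet> e - R = (1 - t) *\<^sub>R (x \<bullet> e - R) + t *\<^sub>R (y \<bullet> e - R)"
    by (simp add: inner_left_distrib algebra_simps)
  then show "ridge_huber \<epsilon> R e ((1 - t) *\<^sub>R x + t *\<^sub>R y)
      \<le> (1 - t) * ridge_huber \<epsilon> R e x + t * ridge_huber \<epsilon> R e y"
    using convex_onD[OF convex_on_huber[OF assms], of t "x \<bullet> e - R" "y \<bullet> e - R"] t
    by (simp add: ridge_huber_def)
qed simp

lemma smooth_function_ridge_huber: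
  fixes e :: "'a::euclidean_space"
  assumes "0 \<le> \<epsilon>" "norm e = 1" "1 \<le> L"
  shows "smooth_function L (ridge_huber \<epsilon> R e)"
  unfolding smooth_function_def
proof
  show "\<forall>x. ridge_huber \<epsilon> R e differentiable (at x)"
    using GDERIV_ridge_huber[OF assms(1)] unfolding gderiv_def differentiable_def by blast
  show "L-lipschitz_on UNIV (gradient (ridge_huber \<epsilon> R e))"
  proof (rule lipschitz_onI)
    fix x y
    have "dist (gradient (ridge_huber \<epsilon> R e) x) (gradient (ridge_huber \<epsilon> R e) y)
        = \<bar>clamp_abs \<epsilon> (x \<bullet> e - R) - clamp_abs \<epsilon> (y \<bullet> e - R)\<bar>"
      by (simp add: gradient_ridge_huber assms dist_norm flip: scaleR_left_diff_distrib)
    \<comment> \<open>The clamp and the inner product with a unit vector are both nonexpansive, so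
      the gradient is 1-Lipschitz and \<open>1 \<le> L\<close> suffices.\<close>
    also have "\<dots> \<le> \<bar>(x - y) \<bullet> e\<bar>"
      using clamp_abs_diff_le[of \<epsilon> "x \<bullet> e - R" "y \<bullet> e - R"] by (simp add: inner_diff_left)
    also have "\<dots> \<le> dist x y"
      using Cauchy_Schwarz_ineq2[of "x - y" e] assms by (simp add: dist_norm)
    also have "\<dots> \<le> L * dist x y"
      using mult_right_mono[OF assms(3), of "dist x y"] by simp
    finally show "dist (gradient (ridge_huber \<epsilon> R e) x) (gradient (ridge_huber \<epsilon> R e) y)
        \<le> L * dist x y" .
  qed (use assms in simp)
qed

lemma minimizer_ridge_huber_iff:
  assumes "0 < \<epsilon>" "norm e = 1"
  shows "minimizer (ridge_huber \<epsilon> R e) w \<longleftrightarrow> w \<bullet> e = R"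
proof -
  have "ridge_huber \<epsilon> R e (R *\<^sub>R e) = 0"
    using assms by (simp add: ridge_huber_def huber_zero_iff dot_square_norm)
  moreover have "0 \<le> ridge_huber \<epsilon> R e v" for v
    using assms by (simp add: ridge_huber_def huber_nonneg)
  ultimately have "minimizer (ridge_huber \<epsilon> R e) w \<longleftrightarrow> ridge_huber \<epsilon> R e w = 0"
    unfolding minimizer_def is_arg_min_linorder by (metis order_antisym)
  then show ?thesis using assms by (simp add: ridge_huber_def huber_zero_iff)
qed

lemma smallest_norm_minimizer_ridge_huber:
  assumes "0 < \<epsilon>" "norm e = 1" "0 \<le> R"
  shows "smallest_norm_minimizer (ridge_huber \<epsilon> R e) (R *\<^sub>R e)"
proof -
  have "norm (R *\<^sub>R e) \<le> norm w" if "w \<bullet> e = R" for w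
    using norm_cauchy_schwarz[of w e] that assms by simp
  moreover have "(R *\<^sub>R e) \<bullet> e = R"
    using assms by (simp add: dot_square_norm)
  ultimately show ?thesis
    unfolding smallest_norm_minimizer_def is_arg_min_linorder
      minimizer_ridge_huber_iff[OF assms(1,2)] by blast
qed

lemma ridge_huber_in_function_class:
  fixes e :: "'a::euclidean_space"
  assumes "0 < \<epsilon>" "norm e = 1" "0 \<le> R" "1 \<le> L"
  shows "ridge_huber \<epsilon> R e \<in> function_class L R"
  using assms convex_on_ridge_huber[of \<epsilon> R e] smooth_function_ridge_huber[of \<epsilon> e L R]
    smallest_norm_minimizer_ridge_huber[of \<epsilon> e R]
  unfolding function_class_def by (auto intro!: exI[of _ "R *\<^sub>R e"])

lemma agp_oracle_zero_ridge_huber: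
  fixes e :: "'a::euclidean_space"
  assumes "0 \<le> \<epsilon>" "norm e = 1"
  shows "agp_oracle \<epsilon> (ridge_huber \<epsilon> R e) (\<lambda>_. 0)"
  using assms by (simp add: agp_oracle_def gradient_ridge_huber abs_clamp_abs_le)

text \<open>The minorant of slope \<open>- \<epsilon>\<close> is at least
  \<open>\<epsilon> * R - \<epsilon>\<^sup>2 / 2\<close> on this half-space, and
  \<open>\<epsilon> \<le> R\<close> lets the quadratic term cost at most half of
  \<open>\<epsilon> * R\<close>.\<close>

lemma ridge_huber_ge:
  assumes "0 \<le> \<epsilon>" "\<epsilon> \<le> R" "w \<bullet> e \<le> 0"
  shows "\<epsilon> * R / 2 \<le> ridge_huber \<epsilon> R e w"
proof -
  have "\<epsilon> * R / 2 \<le> \<epsilon> * R - \<epsilon>\<^sup>2 / 2"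
    using mult_left_mono[OF assms(2,1)] by (simp add: power2_eq_square mult.commute)
  also have "\<dots> \<le> (- \<epsilon>) * (w \<bullet> e - R) - (- \<epsilon>)\<^sup>2 / 2"
    using mult_nonneg_nonpos[OF assms(1,3)] by (simp add: algebra_simps)
  also have "\<dots> \<le> ridge_huber \<epsilon> R e w"
    unfolding ridge_huber_def using assms by (intro huber_ge) simp
  finally show ?thesis .
qed

theorem theorem2:
  fixes R L \<epsilon> :: real
  assumes "R \<ge> 1" and "L \<ge> 1" and "0 < \<epsilon>" and "\<epsilon> \<le> 1"
  shows "\<not> (\<exists>alg :: (real ^ 'n::finite) algorithm.
            \<forall>f \<in> function_class L R. \<forall>orc. agp_oracle \<epsilon> f orc \<longrightarrow>
              (\<forall>wstar. smallest_norm_minimizer f wstar \<longrightarrow>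
                 f (run alg orc) < f wstar + \<epsilon> * R / 2))"
proof
  assume "\<exists>alg :: (real ^ 'n::finite) algorithm.
            \<forall>f \<in> function_class L R. \<forall>orc. agp_oracle \<epsilon> f orc \<longrightarrow>
              (\<forall>wstar. smallest_norm_minimizer f wstar \<longrightarrow>
                 f (run alg orc) < f wstar + \<epsilon> * R / 2)"
  then obtain alg :: "(real ^ 'n) algorithm" where
    guarantee: "\<And>f orc wstar. f \<in> function_class L R \<Longrightarrow> agp_oracle \<epsilon> f orc \<Longrightarrow>
      smallest_norm_minimizer f wstar \<Longrightarrow> f (run alg orc) < f wstar + \<epsilon> * R / 2"
    by blast
  \<comment> \<open>The zero oracle does not involve \<open>e\<close>, so this one output, from a
    finite or an infinite run, must serve all directions at once.\<close>
  define w where "w = run alg (\<lambda>_. 0)"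
  have right_side: "0 < w \<bullet> e" if e: "norm e = 1" for e
  proof (rule ccontr)
    assume "\<not> 0 < w \<bullet> e"
    then have "\<epsilon> * R / 2 \<le> ridge_huber \<epsilon> R e w"
      using assms by (intro ridge_huber_ge) auto
    moreover have "ridge_huber \<epsilon> R e w < ridge_huber \<epsilon> R e (R *\<^sub>R e) + \<epsilon> * R / 2"
      unfolding w_def using assms e
      by (intro guarantee ridge_huber_in_function_class agp_oracle_zero_ridge_huber
          smallest_norm_minimizer_ridge_huber) auto
    moreover have "ridge_huber \<epsilon> R e (R *\<^sub>R e) = 0"
      using assms e by (simp add: ridge_huber_def huber_zero_iff dot_square_norm)
    ultimately show False by simp
  qed
  obtain e :: "real ^ 'n" where "norm e = 1"
    using vector_choose_size[of 1] by auto
  \<comment> \<open>The inner products of \<open>w\<close> with \<open>e\<close> and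
    \<open>- e\<close> sum to zero, so they cannot both be positive.\<close>
  then show False using right_side[of e] right_side[of "- e"] by simp
qed

end
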